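(* Let $\alpha,\zeta,\delta>0$ and $\gamma\in\mathbb{R}$. Let $f$ be the probability density obtained by mixing the reflected Gamma density with shape $\alpha$, location $\gamma$ and scale $\beta$ over a Gamma prior on $\beta$ with parameters $\delta,\zeta$, i.e. $$f(x)=\int_{0}^{\infty} \frac{|x-\gamma|^{\alpha-1}}{2\beta^{\alpha}\Gamma(\alpha)}\exp\left(-\frac{|x-\gamma|}{\beta}\right)\frac{\delta^{\zeta}\beta^{\zeta-1}}{\Gamma(\zeta)}\exp(-\delta\beta)\,d\beta .$$ Then for every real $x$ with $|x-\gamma|>0$, $$f(x)=\frac{\delta^{\frac{\alpha+\zeta}{2}}}{\Gamma(\alpha)\Gamma(\zeta)}\,|x-\gamma|^{\frac{\alpha+\zeta}{2}-1}\,K_{\alpha-\zeta}\left(2\sqrt{\delta|x-\gamma|}\right).$$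
   Context: $\Gamma$ is the Gamma function and $K_\nu$ is the modified Bessel function of the second kind of order $\nu$. The distribution with density $f$ is called the (four-parameter) symmetric K-distribution (SKD) with shape parameters $\alpha,\zeta$, scale parameter $\delta$ and location parameter $\gamma$. *)

theory Defs
  imports "HOL-Analysis.Analysis"
begin

text \<open>
  The modified Bessel functions of real order on the positive half-line.
  \<^term>\<open>rGamma\<close> is the entire function 1/Gamma, so the terms of the series at the poles
  of Gamma vanish, as usual. Because of \<^term>\<open>(powr)\<close>, the definitions are meaningful
  only for \<^term>\<open>x > (0::real)\<close>.
\<close>

definition bessel_I :: "real \<Rightarrow> real \<Rightarrow> real" where
  "bessel_I \<nu> x = (\<Sum>k. rGamma (real k + \<nu> + 1) / fact k * (x / 2) powr (2 * real k + \<nu>))"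

text \<open>
  For integer order the quotient is 0/0 and K is its limit in the order; near an integer all
  other orders are non-integers, so the limit only involves the regular case.
\<close>

definition bessel_K :: "real \<Rightarrow> real \<Rightarrow> real" where
  "bessel_K \<nu> x =
     (let K = (\<lambda>\<mu>. pi / 2 * (bessel_I (- \<mu>) x - bessel_I \<mu> x) / sin (\<mu> * pi))
      in if \<nu> \<in> \<int> then Lim (at \<nu>) K else K \<nu>)"

end

(*
  Substituting beta = |x - gamma| / t turns the density into a multiple of
  G(nu, w) = integral over t > 0 of t^(nu-1) exp(-t - w/t), with nu = alpha - zeta and
  w = delta |x - gamma|. This has to be compared with the combination H(nu, w) of two power
  series that defines K_nu. For non-integer nu both functions X satisfy
  dX(nu)/dw = -X(nu - 1) and X(-nu) = w^(-nu) X(nu), and for nu > 0 both tend to Gamma(nu)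
  as w -> 0. If 0 < nu < 1, the differences G - H at the orders nu and 1 - nu therefore
  solve a homogeneous linear first-order system with vanishing initial values, so they are
  0. Since the derivative at order nu + 1 is determined by order nu, and the initial value
  is known, equality passes from nu to nu + 1, and then to -nu by reflection. Integer
  orders follow by continuity: G is convex, hence continuous, in nu.
*)
theory Submission
  imports Defs
begin

section \<open>The integral G(nu, w): existence, derivative in w, limit at 0\<close>

text \<open>The generalized gamma function of Chaudhry and Zubair; for positive order, w = 0 would
  give Euler's integral for Gamma.\<close>

definition gengamma :: "real \<Rightarrow> real \<Rightarrow> real" where
  "gengamma \<nu> w = integral {0<..} (\<lambda>t. t powr (\<nu> - 1) * exp (- t - w / t))"

lemma has_integral_Gamma_Ioi:
  fixes \<nu> :: real
  assumes "\<nu> > 0"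
  shows "((\<lambda>t. t powr (\<nu> - 1) * exp (- t)) has_integral Gamma \<nu>) {0<..}"
proof -
  have "((\<lambda>t. t powr (\<nu> - 1) / exp t) has_integral Gamma \<nu>) {0<..}"
    using Gamma_integral_real[OF assms]
    by (subst has_integral_spike_set_eq[where T = "{0..}"])
       (auto intro: negligible_subset[OF negligible_sing[of 0]])
  then show ?thesis by (simp add: exp_minus field_simps)
qed

text \<open>As t -> 0 the factor exp(-w/t) decays faster than any power of t. Trading it for a
  multiple of t^m with m large leaves a convergent Gamma integrand of order nu + m, whatever the
  sign of nu.\<close>

lemma gengamma_abs_integrable:
  fixes \<nu> w :: real
  assumes "w > 0"
  shows "(\<lambda>t. t powr (\<nu> - 1) * exp (- t - w / t)) absolutely_integrable_on {0<..}"
proof -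
  define m where "m = \<bar>\<nu>\<bar> + 1"
  have m: "m > 0" "\<nu> + m > 0" by (auto simp: m_def)
  have le: "exp (- (w / t)) \<le> (m / w) powr m * t powr m" if t: "t > 0" for t
  proof -
    \<comment> \<open>Writing the exponential as an m-th power reduces the bound to exp(-u) <= 1/u
      with u = w / (t m).\<close>
    have "exp (- (w / t)) = exp (- (w / (t * m))) powr m"
      using m by (simp add: exp_powr_real)
    also have "\<dots> \<le> (m / w * t) powr m"
    proof (intro powr_mono2)
      have "w / (t * m) \<le> exp (w / (t * m))"
        using exp_ge_add_one_self[of "w / (t * m)"] by linarith
      then have "inverse (exp (w / (t * m))) \<le> inverse (w / (t * m))"
        using t m assms by (intro le_imp_inverse_le) auto
      then show "exp (- (w / (t * m))) \<le> m / w * t"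
        by (simp add: exp_minus field_simps)
    qed (use m in auto)
    also have "\<dots> = (m / w) powr m * t powr m"
      by (rule powr_mult)
    finally show ?thesis .
  qed
  show ?thesis
  proof (rule measurable_bounded_by_integrable_imp_absolutely_integrable)
    show "(\<lambda>t. t powr (\<nu> - 1) * exp (- t - w / t)) \<in> borel_measurable (lebesgue_on {0<..})"
      by (intro continuous_imp_measurable_on_sets_lebesgue continuous_intros) auto
    show "(\<lambda>t. (m / w) powr m * (t powr (\<nu> + m - 1) * exp (- t))) integrable_on {0<..}"
      using has_integral_Gamma_Ioi[OF m(2)] by (intro integrable_on_mult_right) blast
    fix t :: real assume "t \<in> {0<..}"
    then have t: "t > 0" by simp
    have "norm (t powr (\<nu> - 1) * exp (- t - w / t))
        = t powr (\<nu> - 1) * exp (- t) * exp (- (w / t))"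
      by (simp add: abs_mult exp_diff exp_minus field_simps)
    also have "\<dots> \<le> t powr (\<nu> - 1) * exp (- t) * ((m / w) powr m * t powr m)"
      using le[OF t] by (intro mult_left_mono) auto
    also have "\<dots> = (m / w) powr m * (t powr (\<nu> + m - 1) * exp (- t))"
      using t by (simp add: powr_add powr_diff field_simps)
    finally show "norm (t powr (\<nu> - 1) * exp (- t - w / t))
        \<le> (m / w) powr m * (t powr (\<nu> + m - 1) * exp (- t))" .
  qed auto
qed

lemma gengamma_integrable:
  fixes \<nu> w :: real
  assumes "w > 0"
  shows "(\<lambda>t. t powr (\<nu> - 1) * exp (- t - w / t)) integrable_on {0<..}"
  using gengamma_abs_integrable[OF assms] by (rule set_lebesgue_integral_eq_integral)

lemma gengamma_has_integral:
  fixes \<nu> w :: real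
  assumes "w > 0"
  shows "((\<lambda>t. t powr (\<nu> - 1) * exp (- t - w / t)) has_integral gengamma \<nu> w) {0<..}"
  using gengamma_integrable[OF assms] unfolding gengamma_def by (rule integrable_integral)

text \<open>By convexity the graph of exp(-x) lies above its tangents. The tangent at a makes the
  remainder nonnegative; the one at b bounds it by (b - a)(exp(-a) - exp(-b)), and a Lipschitz
  estimate with constant exp(-c) supplies the second factor |b - a|.\<close>

lemma exp_minus_taylor_bounds:
  fixes a b c :: real
  assumes "c \<le> a" "c \<le> b"
  shows "\<bar>exp (- b) - exp (- a) + (b - a) * exp (- a)\<bar> \<le> (b - a)\<^sup>2 * exp (- c)"
proof -
  have tangent: "(x - y) * exp (- x) \<le> exp (- y) - exp (- x)" for x y :: real
  proof -
    have "(1 + (x - y)) * exp (- x) \<le> exp (x - y) * exp (- x)"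
      by (intro mult_right_mono exp_ge_add_one_self) auto
    then show ?thesis by (simp add: algebra_simps flip: exp_add)
  qed
  have lower: "0 \<le> exp (- b) - exp (- a) + (b - a) * exp (- a)"
    using tangent[of a b] by (simp add: algebra_simps)
  have "exp (- b) - exp (- a) + (b - a) * exp (- a) \<le> (b - a) * (exp (- a) - exp (- b))"
    using tangent[of b a] by (simp add: algebra_simps)
  also have "\<dots> \<le> \<bar>b - a\<bar> * \<bar>exp (- a) - exp (- b)\<bar>"
    by (simp flip: abs_mult)
  also have "\<bar>exp (- a) - exp (- b)\<bar> \<le> \<bar>b - a\<bar> * exp (- c)"
  proof -
    have 1: "\<bar>b - a\<bar> * exp (- a) \<le> \<bar>b - a\<bar> * exp (- c)" "\<bar>b - a\<bar> * exp (- b) \<le> \<bar>b - a\<bar> * exp (- c)"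
      using assms by (auto intro!: mult_left_mono)
    show ?thesis
    proof (cases "a \<le> b")
      case True
      then show ?thesis using tangent[of a b] 1 by (simp add: algebra_simps)
    next
      case False
      then show ?thesis using tangent[of b a] 1 by (simp add: algebra_simps)
    qed
  qed
  finally have "exp (- b) - exp (- a) + (b - a) * exp (- a) \<le> \<bar>b - a\<bar> * (\<bar>b - a\<bar> * exp (- c))"
    by (simp add: mult_left_mono)
  also have "\<dots> = (b - a)\<^sup>2 * exp (- c)"
    by (simp add: power2_eq_square flip: mult.assoc)
  finally show ?thesis using lower by simp
qed

lemma has_integral_norm_bound_real:
  fixes f g :: "real \<Rightarrow> real"
  assumes "(f has_integral i) S" "(g has_integral j) S" "\<And>x. x \<in> S \<Longrightarrow> norm (f x) \<le> g x"
  shows "norm i \<le> j"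
  using has_integral_norm_bound_integral_component[OF assms(1,2), of 1] assms(3) by simp

text \<open>The pointwise Taylor bound for exp(-w/t) is integrated over t. The square of the
  increment h/t lowers the order by 2, and w/2, a lower bound for both w and w + h, keeps the
  bounding integral independent of h.\<close>

lemma gengamma_taylor_bound:
  fixes \<nu> w h :: real
  assumes "w > 0" and h: "\<bar>h\<bar> \<le> w / 2"
  shows "\<bar>gengamma \<nu> (w + h) - gengamma \<nu> w + h * gengamma (\<nu> - 1) w\<bar>
    \<le> h\<^sup>2 * gengamma (\<nu> - 2) (w / 2)"
proof -
  define F where "F = (\<lambda>\<nu> w t :: real. t powr (\<nu> - 1) * exp (- t - w / t))"
  have int: "(F \<mu> v has_integral gengamma \<mu> v) {0<..}" if "v > 0" for \<mu> v
    unfolding F_def by (rule gengamma_has_integral[OF that])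
  have wh: "w + h > 0" "w / 2 > 0" "w / 2 \<le> w" "w / 2 \<le> w + h"
    using assms by linarith+
  let ?f = "\<lambda>t. F \<nu> (w + h) t - F \<nu> w t + h * F (\<nu> - 1) w t"
  have "(?f has_integral (gengamma \<nu> (w + h) - gengamma \<nu> w + h * gengamma (\<nu> - 1) w)) {0<..}"
    using wh assms by (intro has_integral_add has_integral_diff has_integral_mult_right int)
  moreover have "((\<lambda>t. h\<^sup>2 * F (\<nu> - 2) (w / 2) t) has_integral
      h\<^sup>2 * gengamma (\<nu> - 2) (w / 2)) {0<..}"
    using wh by (intro has_integral_mult_right int)
  moreover have "norm (?f t) \<le> h\<^sup>2 * F (\<nu> - 2) (w / 2) t" if "t \<in> {0<..}" for t
  proof -
    from that have t: "t > 0" by simp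
    define a where "a = w / t"
    define b where "b = (w + h) / t"
    have ba: "b - a = h / t" by (simp add: a_def b_def add_divide_distrib)
    have "?f t = t powr (\<nu> - 1) * exp (- t) * (exp (- b) - exp (- a) + (b - a) * exp (- a))"
      unfolding ba using t
      by (simp add: F_def a_def b_def powr_diff exp_diff exp_minus field_simps)
    then have "norm (?f t)
        = t powr (\<nu> - 1) * exp (- t) * \<bar>exp (- b) - exp (- a) + (b - a) * exp (- a)\<bar>"
      by (simp add: abs_mult)
    also have "\<dots> \<le> t powr (\<nu> - 1) * exp (- t) * ((b - a)\<^sup>2 * exp (- (w / 2 / t)))"
      using t wh unfolding a_def b_def
      by (intro mult_left_mono exp_minus_taylor_bounds divide_right_mono) auto
    also have "\<dots> = h\<^sup>2 * F (\<nu> - 2) (w / 2) t"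
      unfolding ba using t
      by (simp add: F_def powr_diff exp_diff exp_minus field_simps power2_eq_square powr_numeral flip: powr_realpow)
    finally show ?thesis .
  qed
  ultimately show ?thesis
    unfolding real_norm_def[symmetric] by (rule has_integral_norm_bound_real)
qed

lemma DERIV_gengamma:
  fixes \<nu> w :: real
  assumes "w > 0"
  shows "(gengamma \<nu> has_field_derivative - gengamma (\<nu> - 1) w) (at w)"
  unfolding DERIV_def
proof (rule LIM_zero_cancel, rule Lim_null_comparison)
  let ?C = "gengamma (\<nu> - 2) (w / 2)"
  show "((\<lambda>h. \<bar>h\<bar> * ?C) \<longlongrightarrow> 0) (at 0)"
    by (auto intro!: tendsto_eq_intros)
  have "\<forall>\<^sub>F h in at 0. h \<noteq> 0 \<and> \<bar>h\<bar> \<le> w / 2"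
    unfolding eventually_at using assms by (intro exI[of _ "w / 2"]) auto
  then show "\<forall>\<^sub>F h in at 0.
      norm ((gengamma \<nu> (w + h) - gengamma \<nu> w) / h - - gengamma (\<nu> - 1) w) \<le> \<bar>h\<bar> * ?C"
  proof eventually_elim
    case (elim h)
    have "norm ((gengamma \<nu> (w + h) - gengamma \<nu> w) / h - - gengamma (\<nu> - 1) w)
        = \<bar>gengamma \<nu> (w + h) - gengamma \<nu> w + h * gengamma (\<nu> - 1) w\<bar> / \<bar>h\<bar>"
      using elim by (simp add: field_simps flip: abs_divide)
    also have "\<dots> \<le> (h\<^sup>2 * ?C) / \<bar>h\<bar>"
      using elim assms by (intro divide_right_mono gengamma_taylor_bound) auto
    also have "\<dots> = \<bar>h\<bar> * ?C"
      using elim by (cases "h > 0") (simp_all add: power2_eq_square)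
    finally show ?case .
  qed
qed

text \<open>The integrands of G(nu, w) and Gamma(nu) differ by the factor 1 - exp(-w/t), which is at
  most (w/t)^s for 0 < s <= 1. Integration gives an error of at most w^s Gamma(nu - s).\<close>

lemma tendsto_gengamma_0:
  fixes \<nu> :: real
  assumes "\<nu> > 0"
  shows "(gengamma \<nu> \<longlongrightarrow> Gamma \<nu>) (at_right 0)"
proof (rule LIM_zero_cancel, rule Lim_null_comparison)
  \<comment> \<open>The bound s <= 1 serves the inequality 1 - exp(-x) <= x^s, and s < nu makes
    Gamma(nu - s) a convergent integral.\<close>
  define s where "s = min 1 (\<nu> / 2)"
  have s: "0 < s" "s \<le> 1" "0 < \<nu> - s" using assms by (auto simp: s_def)
  show "((\<lambda>w. w powr s * Gamma (\<nu> - s)) \<longlongrightarrow> 0) (at_right 0)"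
    using s by (auto intro!: tendsto_eq_intros eventually_mono[OF eventually_at_right_less])
  have "\<forall>\<^sub>F w in at_right 0. (w::real) > 0"
    by (rule eventually_at_right_less)
  then show "\<forall>\<^sub>F w in at_right 0. norm (gengamma \<nu> w - Gamma \<nu>) \<le> w powr s * Gamma (\<nu> - s)"
  proof eventually_elim
    case (elim w)
    let ?f = "\<lambda>t. t powr (\<nu> - 1) * exp (- t - w / t) - t powr (\<nu> - 1) * exp (- t)"
    have "(?f has_integral (gengamma \<nu> w - Gamma \<nu>)) {0<..}"
      using elim assms by (intro has_integral_diff gengamma_has_integral has_integral_Gamma_Ioi)
    moreover have "((\<lambda>t. w powr s * (t powr (\<nu> - s - 1) * exp (- t))) has_integral
        w powr s * Gamma (\<nu> - s)) {0<..}"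
      using s by (intro has_integral_mult_right has_integral_Gamma_Ioi)
    moreover have "norm (?f t) \<le> w powr s * (t powr (\<nu> - s - 1) * exp (- t))"
      if "t \<in> {0<..}" for t
    proof -
      from that have t: "t > 0" by simp
      define x where "x = w / t"
      have x: "x > 0" using t elim by (simp add: x_def)
      have "1 - exp (- x) \<le> x powr s"
      proof (cases "x \<le> 1")
        case True
        have "1 - exp (- x) \<le> x powr 1"
          using exp_ge_add_one_self[of "-x"] x by simp
        also have "\<dots> \<le> x powr s" using True x s by (intro powr_mono') auto
        finally show ?thesis .
      next
        case False
        then have "1 \<le> x powr s" using s by (intro ge_one_powr_ge_zero) auto
        then show ?thesis using exp_gt_zero[of "-x"] by linarith
      qed
      then have "t powr (\<nu> - 1) * exp (- t) * (1 - exp (- x))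
          \<le> t powr (\<nu> - 1) * exp (- t) * x powr s"
        by (intro mult_left_mono) auto
      also have "\<dots> = w powr s * (t powr (\<nu> - s - 1) * exp (- t))"
        using t elim by (simp add: x_def powr_divide powr_diff powr_add field_simps)
      also have "t powr (\<nu> - 1) * exp (- t) * (1 - exp (- x)) = norm (?f t)"
      proof -
        have "?f t = - (t powr (\<nu> - 1) * exp (- t) * (1 - exp (- x)))"
          by (simp add: x_def exp_diff exp_minus field_simps)
        moreover have "0 \<le> t powr (\<nu> - 1) * exp (- t) * (1 - exp (- x))"
          using x by simp
        ultimately show ?thesis by simp
      qed
      finally show ?thesis .
    qed
    ultimately show ?case
      by (rule has_integral_norm_bound_real)
  qed
qed

section \<open>Reflection in the order, and continuity in the order\<close>

text \<open>The substitution t -> c/t maps the half-line onto itself and swaps the two terms of the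
  exponent. The case a = 1 is the reflection formula for G; general a fits the mixture integral of
  the density.\<close>

lemma gengamma_reflect_scale:
  fixes \<nu> a c :: real
  assumes "a > 0" "c > 0"
  defines "f \<equiv> (\<lambda>t. t powr (- \<nu> - 1) * exp (- (a * t) - c / t))"
  shows "f absolutely_integrable_on {0<..}"
    and "integral {0<..} f = c powr (- \<nu>) * gengamma \<nu> (a * c)"
proof -
  let ?g = "\<lambda>t. c / t" and ?g' = "\<lambda>t. - c / t\<^sup>2"
  have img: "?g ` {0<..} = {0<..}"
  proof (intro equalityI subsetI)
    fix x :: real assume "x \<in> {0<..}"
    then show "x \<in> ?g ` {0<..}" using assms by (intro image_eqI[of _ _ "c / x"]) auto
  qed (use assms in auto)
  have eq: "\<bar>?g' t\<bar> * f (?g t) = c powr (- \<nu>) * (t powr (\<nu> - 1) * exp (- t - a * c / t))"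
    if "t \<in> {0<..}" for t
  proof -
    from that have t: "t > 0" by simp
    have "\<bar>?g' t\<bar> * f (?g t) = c / t\<^sup>2 * ((c / t) powr (- \<nu> - 1) * exp (- t - a * c / t))"
      using t assms by (simp add: f_def mult.commute)
    also have "(c / t) powr (- \<nu> - 1) = c powr (-\<nu>) * t powr (\<nu> - 1) * t\<^sup>2 / c"
      using t assms by (simp add: powr_divide powr_diff powr_minus field_simps power2_eq_square)
    finally show ?thesis using t assms by (simp add: field_simps)
  qed
  have "(\<lambda>t. \<bar>?g' t\<bar> * f (?g t)) absolutely_integrable_on {0<..} \<and>
      integral {0<..} (\<lambda>t. \<bar>?g' t\<bar> * f (?g t)) = c powr (- \<nu>) * gengamma \<nu> (a * c)"
  proof
    show "integral {0<..} (\<lambda>t. \<bar>?g' t\<bar> * f (?g t)) = c powr (- \<nu>) * gengamma \<nu> (a * c)"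
      unfolding gengamma_def integral_mult_right[symmetric]
      by (intro Henstock_Kurzweil_Integration.integral_cong eq)
    have "(\<lambda>t. c powr (- \<nu>) * (t powr (\<nu> - 1) * exp (- t - a * c / t)))
        absolutely_integrable_on {0<..}"
      using assms by (intro set_integrable_mult_right gengamma_abs_integrable) auto
    then show "(\<lambda>t. \<bar>?g' t\<bar> * f (?g t)) absolutely_integrable_on {0<..}"
      using eq by (subst set_integrable_cong[OF refl refl eq]) auto
  qed
  moreover have "(?g has_field_derivative ?g' t) (at t within {0<..})" if "t \<in> {0<..}" for t
    using that by (auto intro!: derivative_eq_intros simp: power2_eq_square)
  moreover have "inj_on ?g {0<..}" using assms by (auto intro!: inj_onI)
  ultimately have "f absolutely_integrable_on ?g ` {0<..} \<and>
      integral (?g ` {0<..}) f = c powr (- \<nu>) * gengamma \<nu> (a * c)"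
    using has_absolute_integral_change_of_variables_1'[of "{0<..}" ?g ?g' f] by auto
  then show "f absolutely_integrable_on {0<..}"
    and "integral {0<..} f = c powr (- \<nu>) * gengamma \<nu> (a * c)"
    unfolding img by auto
qed

lemma gengamma_minus:
  fixes \<nu> w :: real
  assumes "w > 0"
  shows "gengamma (- \<nu>) w = w powr (- \<nu>) * gengamma \<nu> w"
  using gengamma_reflect_scale(2)[of 1 w \<nu>] assms by (simp add: gengamma_def)

text \<open>For fixed t > 0 the power t^(nu - 1) = exp((nu - 1) ln t) is convex in nu, and
  integration against a positive weight preserves this.\<close>

lemma convex_on_gengamma:
  fixes w :: real
  assumes "w > 0"
  shows "convex_on UNIV (\<lambda>\<nu>. gengamma \<nu> w)"
proof (rule convex_onI)
  fix u \<mu> \<nu> :: real assume u: "0 < u" "u < 1"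
  let ?F = "\<lambda>\<nu> t. t powr (\<nu> - 1) * exp (- t - w / t)"
  let ?m = "(1 - u) *\<^sub>R \<mu> + u *\<^sub>R \<nu>"
  show "gengamma ?m w \<le> (1 - u) * gengamma \<mu> w + u * gengamma \<nu> w"
  proof (rule has_integral_le)
    show "(?F ?m has_integral gengamma ?m w) {0<..}"
      using assms by (rule gengamma_has_integral)
    show "((\<lambda>t. (1 - u) * ?F \<mu> t + u * ?F \<nu> t) has_integral
        (1 - u) * gengamma \<mu> w + u * gengamma \<nu> w) {0<..}"
      using assms by (intro has_integral_add has_integral_mult_right gengamma_has_integral)
    fix t :: real assume "t \<in> {0<..}"
    then have t: "t > 0" by simp
    have "exp ((1 - u) *\<^sub>R ((\<mu> - 1) * ln t) + u *\<^sub>R ((\<nu> - 1) * ln t))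
        \<le> (1 - u) * exp ((\<mu> - 1) * ln t) + u * exp ((\<nu> - 1) * ln t)"
      using u by (intro convex_onD[OF exp_convex]) auto
    then have "t powr (?m - 1) \<le> (1 - u) * t powr (\<mu> - 1) + u * t powr (\<nu> - 1)"
      using t by (simp add: powr_def algebra_simps)
    then have "t powr (?m - 1) * exp (- t - w / t)
        \<le> ((1 - u) * t powr (\<mu> - 1) + u * t powr (\<nu> - 1)) * exp (- t - w / t)"
      by (intro mult_right_mono) auto
    then show "?F ?m t \<le> (1 - u) * ?F \<mu> t + u * ?F \<nu> t"
      by (simp add: algebra_simps)
  qed
qed auto

lemma isCont_gengamma_order:
  fixes \<nu> w :: real
  assumes "w > 0"
  shows "isCont (\<lambda>\<nu>. gengamma \<nu> w) \<nu>"
  using convex_on_continuous[OF open_UNIV convex_on_gengamma[OF assms]]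
  by (simp add: continuous_on_eq_continuous_at)

section \<open>The power series and the combination H(nu, w)\<close>

text \<open>The Bessel-Clifford function: I_nu(2 sqrt w) without its factor w^(nu/2), hence an
  entire function of w, regular at 0.\<close>

definition bessel_series :: "real \<Rightarrow> real \<Rightarrow> real" where
  "bessel_series \<nu> w = (\<Sum>k. rGamma (real k + \<nu> + 1) / fact k * w ^ k)"

text \<open>Ratio test with consecutive terms in ratio w / ((k + 1)(k + nu + 1)). The relation is
  kept in multiplied form, since terms can vanish at the poles of Gamma.\<close>

lemma summable_bessel_series:
  fixes \<nu> w :: real
  shows "summable (\<lambda>k. rGamma (real k + \<nu> + 1) / fact k * w ^ k)"
proof (rule summable_ratio_test[of "1 / 2"])
  let ?f = "\<lambda>k. rGamma (real k + \<nu> + 1) / fact k * w ^ k"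
  \<comment> \<open>From this index on k + 1 >= 2|w| and k + nu + 1 >= 1, so the ratio is at most
    1/2 in absolute value.\<close>
  fix k :: nat assume "nat \<lceil>\<bar>\<nu>\<bar> + 2 * \<bar>w\<bar>\<rceil> \<le> k"
  then have k: "\<bar>\<nu>\<bar> + 2 * \<bar>w\<bar> \<le> real k" by linarith
  have "rGamma (real k + \<nu> + 1) = (real k + \<nu> + 1) * rGamma (real (Suc k) + \<nu> + 1)"
    using rGamma_plus1[of "real k + \<nu> + 1"] by (simp add: add_ac)
  then have "w * ?f k = (real k + 1) * (real k + \<nu> + 1) * ?f (Suc k)"
    by (simp add: divide_simps)
  then have eq: "\<bar>w\<bar> * \<bar>?f k\<bar> = (real k + 1) * (real k + \<nu> + 1) * \<bar>?f (Suc k)\<bar>"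
  proof -
    have "\<bar>real k + 1\<bar> = real k + 1" "\<bar>real k + \<nu> + 1\<bar> = real k + \<nu> + 1"
      using k by linarith+
    with \<open>w * ?f k = _\<close> show ?thesis by (metis abs_mult)
  qed
  have "2 * \<bar>w\<bar> * 1 \<le> (real k + 1) * (real k + \<nu> + 1)"
    using k by (intro mult_mono) linarith+
  then have "2 * \<bar>w\<bar> * \<bar>?f (Suc k)\<bar> \<le> (real k + 1) * (real k + \<nu> + 1) * \<bar>?f (Suc k)\<bar>"
    by (intro mult_right_mono) auto
  then have "\<bar>w\<bar> * (2 * \<bar>?f (Suc k)\<bar>) \<le> \<bar>w\<bar> * \<bar>?f k\<bar>"
    using eq by (simp add: mult_ac)
  then have "2 * \<bar>?f (Suc k)\<bar> \<le> \<bar>?f k\<bar>" if "w \<noteq> 0"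
    by (rule mult_left_le_imp_le) (simp add: that)
  then show "norm (?f (Suc k)) \<le> 1 / 2 * norm (?f k)"
    by (cases "w = 0") auto
qed auto

lemma of_nat_Suc_mult_divide_fact:
  fixes x :: real
  shows "real (Suc k) * (x / fact (Suc k)) = x / fact k"
  by (simp add: fact_Suc del: of_nat_Suc)

lemma DERIV_bessel_series:
  fixes \<nu> w :: real
  shows "(bessel_series \<nu> has_field_derivative bessel_series (\<nu> + 1) w) (at w)"
proof -
  let ?c = "\<lambda>k. rGamma (real k + \<nu> + 1) / fact k"
  have "diffs ?c = (\<lambda>k. rGamma (real k + (\<nu> + 1) + 1) / fact k)"
    by (simp only: diffs_def of_nat_Suc_mult_divide_fact) (simp add: add_ac)
  then show ?thesis
    using termdiffs_strong_converges_everywhere[of ?c w, OF summable_bessel_series]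
    unfolding bessel_series_def by simp
qed

text \<open>Coefficientwise, 1/Gamma(k + nu) = (k + nu) / Gamma(k + nu + 1). The summand nu
  reproduces the series of order nu; the summand k cancels against k! and shifts the index, giving w
  times the series of order nu + 1.\<close>

lemma bessel_series_rec:
  fixes \<nu> w :: real
  shows "bessel_series (\<nu> - 1) w = \<nu> * bessel_series \<nu> w + w * bessel_series (\<nu> + 1) w"
proof -
  let ?c = "\<lambda>\<nu> k. rGamma (real k + \<nu> + 1) / fact k * w ^ k"
  have s: "(\<lambda>k. ?c \<mu> k) sums bessel_series \<mu> w" for \<mu>
    unfolding bessel_series_def by (rule summable_sums[OF summable_bessel_series])
  have "(\<lambda>k. real k * ?c \<nu> k) sums (w * bessel_series (\<nu> + 1) w)"
  proof -
    have "(\<lambda>k. real (Suc k) * ?c \<nu> (Suc k)) sums (w * bessel_series (\<nu> + 1) w)"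
    proof -
      have "real (Suc k) * ?c \<nu> (Suc k) = w * ?c (\<nu> + 1) k" for k
        by (simp only: mult.assoc[symmetric] of_nat_Suc_mult_divide_fact) (simp add: add_ac)
      then show ?thesis using sums_mult[OF s[of "\<nu> + 1"], of w] by (simp add: mult_ac)
    qed
    \<comment> \<open>The term for k = 0 carries the factor 0, so the sum from 1 is the whole
      sum.\<close>
    then show ?thesis by (subst (asm) sums_Suc_iff) simp
  qed
  then have "(\<lambda>k. \<nu> * ?c \<nu> k + real k * ?c \<nu> k) sums
      (\<nu> * bessel_series \<nu> w + w * bessel_series (\<nu> + 1) w)"
    by (intro sums_add sums_mult s)
  moreover have "\<nu> * ?c \<nu> k + real k * ?c \<nu> k = ?c (\<nu> - 1) k" for k
  proof -
    have "rGamma (real k + (\<nu> - 1) + 1) = (real k + \<nu>) * rGamma (real k + \<nu> + 1)"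
      using rGamma_plus1[of "real k + \<nu>"] by simp
    then show ?thesis by (simp only:) (simp add: algebra_simps add_divide_distrib)
  qed
  ultimately show ?thesis using s[of "\<nu> - 1"] by (simp add: sums_unique2)
qed

text \<open>For non-integer nu this is 2 w^(nu/2) K_nu(2 sqrt w). At integer orders the sine is 0
  and division by zero makes the value 0.\<close>

definition bessel_comb :: "real \<Rightarrow> real \<Rightarrow> real" where
  "bessel_comb \<nu> w =
     pi / sin (\<nu> * pi) * (bessel_series (- \<nu>) w - w powr \<nu> * bessel_series \<nu> w)"

text \<open>The recurrence collapses the product rule for w^nu times the series into w^(nu - 1)
  times the series of order nu - 1; the minus sign comes from the sine, which changes sign under a
  shift by pi.\<close>

lemma DERIV_bessel_comb:
  fixes \<nu> w :: real
  assumes "w > 0"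
  shows "(bessel_comb \<nu> has_field_derivative - bessel_comb (\<nu> - 1) w) (at w)"
proof -
  have "sin ((\<nu> - 1) * pi) = - sin (\<nu> * pi)"
    by (simp add: left_diff_distrib sin_diff)
  moreover have "w powr \<nu> * bessel_series (\<nu> + 1) w + \<nu> * w powr (\<nu> - 1) * bessel_series \<nu> w
      = w powr (\<nu> - 1) * bessel_series (\<nu> - 1) w"
    using assms by (simp add: bessel_series_rec[of \<nu>] powr_diff field_simps)
  ultimately have "pi / sin (\<nu> * pi) * (bessel_series (- \<nu> + 1) w -
      (w powr \<nu> * bessel_series (\<nu> + 1) w + \<nu> * w powr (\<nu> - 1) * bessel_series \<nu> w))
      = - bessel_comb (\<nu> - 1) w"
    by (simp add: bessel_comb_def add.commute)
  moreover have "(bessel_comb \<nu> has_field_derivative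
      pi / sin (\<nu> * pi) * (bessel_series (- \<nu> + 1) w -
      (w powr \<nu> * bessel_series (\<nu> + 1) w + \<nu> * w powr (\<nu> - 1) * bessel_series \<nu> w))) (at w)"
    unfolding bessel_comb_def using assms
    by (intro DERIV_cmult DERIV_diff DERIV_bessel_series)
       (auto intro!: derivative_eq_intros DERIV_bessel_series simp: mult_ac)
  ultimately show ?thesis by simp
qed

lemma bessel_comb_minus:
  fixes \<nu> w :: real
  assumes "w > 0"
  shows "bessel_comb (- \<nu>) w = w powr (- \<nu>) * bessel_comb \<nu> w"
  using assms by (simp add: bessel_comb_def powr_minus field_simps) (simp add: diff_divide_distrib)

lemma sin_mult_pi_nonzero:
  fixes \<nu> :: real
  assumes "\<nu> \<notin> \<int>"
  shows "sin (\<nu> * pi) \<noteq> 0"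
  using assms by (auto simp: sin_zero_iff_int2)

text \<open>As w -> 0 the power w^nu removes the second series, and the first tends to 1/Gamma(1 -
  nu). Euler's reflection formula turns the remaining constant into Gamma(nu).\<close>

lemma tendsto_bessel_comb_0:
  fixes \<nu> :: real
  assumes "\<nu> > 0" "\<nu> \<notin> \<int>"
  shows "(bessel_comb \<nu> \<longlongrightarrow> Gamma \<nu>) (at_right 0)"
proof -
  have "bessel_series \<mu> 0 = rGamma (\<mu> + 1)" for \<mu>
    unfolding bessel_series_def by (subst powser_zero) simp
  moreover have "(bessel_series \<mu> \<longlongrightarrow> bessel_series \<mu> 0) (at_right 0)" for \<mu>
    using DERIV_isCont[OF DERIV_bessel_series[of \<mu> 0]]
    by (simp add: isCont_def filterlim_at_split)
  ultimately have S: "(bessel_series \<mu> \<longlongrightarrow> rGamma (\<mu> + 1)) (at_right 0)" for \<mu>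
    by simp
  have "((\<lambda>w. w powr \<nu>) \<longlongrightarrow> 0) (at_right 0)"
    using assms by (auto intro!: tendsto_eq_intros eventually_mono[OF eventually_at_right_less])
  then have "(bessel_comb \<nu> \<longlongrightarrow>
      pi / sin (\<nu> * pi) * (rGamma (- \<nu> + 1) - 0 * rGamma (\<nu> + 1))) (at_right 0)"
    unfolding bessel_comb_def by (intro tendsto_intros S)
  moreover have "pi / sin (\<nu> * pi) * rGamma (- \<nu> + 1) = Gamma \<nu>"
  proof -
    \<comment> \<open>The reflection formula is taken over the complex numbers and carried back to
      real arguments.\<close>
    have "complex_of_real (rGamma \<nu> * rGamma (1 - \<nu>)) = complex_of_real (sin (\<nu> * pi) / pi)"
      using rGamma_reflection_complex[of "of_real \<nu>"] rGamma_complex_of_real[of "1 - \<nu>"]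
        sin_of_real[of "\<nu> * pi"]
      by (simp add: rGamma_complex_of_real mult.commute)
    then have "rGamma \<nu> * rGamma (1 - \<nu>) = sin (\<nu> * pi) / pi"
      by (simp only: of_real_eq_iff)
    then show ?thesis
      using sin_mult_pi_nonzero[OF assms(2)] Gamma_real_pos[OF assms(1)]
      by (simp add: Gamma_def field_simps)
  qed
  ultimately show ?thesis by simp
qed

section \<open>Uniqueness for the differential system\<close>

lemma nonpos_if_DERIV_nonpos_tendsto_0:
  fixes f f' :: "real \<Rightarrow> real" and w :: real
  assumes "\<And>x. x > 0 \<Longrightarrow> (f has_field_derivative f' x) (at x)"
    and "\<And>x. x > 0 \<Longrightarrow> f' x \<le> 0"
    and "(f \<longlongrightarrow> 0) (at_right 0)" and "w > 0"
  shows "f w \<le> 0"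
proof (rule tendsto_lowerbound[OF assms(3)])
  have "\<forall>\<^sub>F x in at_right 0. 0 < x \<and> x < w"
    using assms(4) by (auto simp: eventually_at_right_field)
  then show "\<forall>\<^sub>F x in at_right 0. f w \<le> f x"
  proof eventually_elim
    case (elim x)
    show ?case
    proof (rule DERIV_nonpos_imp_nonincreasing[of x w f])
      show "\<exists>y. (f has_field_derivative y) (at z) \<and> y \<le> 0" if "x \<le> z" "z \<le> w" for z
        using assms(1,2)[of z] elim that by (intro exI[of _ "f' z"]) auto
    qed (use elim in simp)
  qed
qed auto

text \<open>
  Gronwall's argument for the squared norm of the solution; the coefficients of the system
  are integrable at 0, although unbounded.
\<close>

lemma singular_system_unique:
  fixes \<nu> w :: real and p q :: "real \<Rightarrow> real"
  assumes \<nu>: "0 < \<nu>" "\<nu> < 1"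
    and p: "\<And>x. x > 0 \<Longrightarrow> (p has_field_derivative - (x powr (\<nu> - 1) * q x)) (at x)"
    and q: "\<And>x. x > 0 \<Longrightarrow> (q has_field_derivative - (x powr (- \<nu>) * p x)) (at x)"
    and p0: "(p \<longlongrightarrow> 0) (at_right 0)" and q0: "(q \<longlongrightarrow> 0) (at_right 0)"
    and w: "w > 0"
  shows "p w = 0"
proof -
  \<comment> \<open>\<open>A\<close> is an antiderivative of the sum of the two coefficients and
    vanishes at 0. With exp(-A) as integrating factor, the cross term -2pq is completed to -(p +
    q)^2, so \<open>V\<close> is nonincreasing.\<close>
  define A where "A = (\<lambda>x. x powr \<nu> / \<nu> + x powr (1 - \<nu>) / (1 - \<nu>))"
  define V where "V = (\<lambda>x. ((p x)\<^sup>2 + (q x)\<^sup>2) * exp (- A x))"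
  define V' where "V' = (\<lambda>x. - ((x powr (\<nu> - 1) + x powr (- \<nu>)) * (p x + q x)\<^sup>2 * exp (- A x)))"
  have A: "(A has_field_derivative x powr (\<nu> - 1) + x powr (- \<nu>)) (at x)" if "x > 0" for x
    unfolding A_def using that \<nu> by (auto intro!: derivative_eq_intros)
  have "(V has_field_derivative V' x) (at x)" if "x > 0" for x
    unfolding V_def
    by (rule derivative_eq_intros p q A that refl)+
       (simp add: V'_def algebra_simps power2_eq_square)
  moreover have "V' x \<le> 0" for x by (simp add: V'_def)
  moreover have "(V \<longlongrightarrow> 0) (at_right 0)"
  proof -
    have "((\<lambda>x. x powr s) \<longlongrightarrow> 0) (at_right 0)" if "s > 0" for s :: real
      using that by (auto intro!: tendsto_eq_intros eventually_mono[OF eventually_at_right_less])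
    then have "(A \<longlongrightarrow> 0 / \<nu> + 0 / (1 - \<nu>)) (at_right 0)"
      unfolding A_def using \<nu> by (intro tendsto_intros) auto
    then have "(V \<longlongrightarrow> (0\<^sup>2 + 0\<^sup>2) * exp (- (0 / \<nu> + 0 / (1 - \<nu>)))) (at_right 0)"
      unfolding V_def by (intro tendsto_intros p0 q0)
    then show ?thesis by simp
  qed
  ultimately have "V w \<le> 0" using w by (rule nonpos_if_DERIV_nonpos_tendsto_0)
  then have "(p w)\<^sup>2 + (q w)\<^sup>2 \<le> 0" by (simp add: V_def mult_le_0_iff)
  then show ?thesis by (simp add: sum_power2_le_zero_iff)
qed

section \<open>Equality of the integral and the combination\<close>

lemma gengamma_eq_bessel_comb_01:
  fixes \<nu> w :: real
  assumes \<nu>: "0 < \<nu>" "\<nu> < 1" and "w > 0"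
  shows "gengamma \<nu> w = bessel_comb \<nu> w"
proof -
  define d where "d = (\<lambda>\<mu> x. gengamma \<mu> x - bessel_comb \<mu> x)"
  have der: "(d \<mu> has_field_derivative - (x powr (\<mu> - 1) * d (1 - \<mu>) x)) (at x)"
    if "x > 0" for \<mu> x
  proof -
    \<comment> \<open>Reflection replaces order mu - 1 by 1 - mu, so the orders nu and 1 - nu form a
      closed system.\<close>
    have "d (\<mu> - 1) x = x powr (\<mu> - 1) * d (1 - \<mu>) x"
      using gengamma_minus[OF that, of "1 - \<mu>"] bessel_comb_minus[OF that, of "1 - \<mu>"]
      by (simp add: d_def algebra_simps)
    moreover have "(d \<mu> has_field_derivative - gengamma (\<mu> - 1) x - - bessel_comb (\<mu> - 1) x) (at x)"
      unfolding d_def by (intro DERIV_diff DERIV_gengamma DERIV_bessel_comb that)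
    moreover have "- gengamma (\<mu> - 1) x - - bessel_comb (\<mu> - 1) x = - d (\<mu> - 1) x"
      by (simp add: d_def)
    ultimately show ?thesis by (simp only:)
  qed
  have lim: "(d \<mu> \<longlongrightarrow> 0) (at_right 0)" if "0 < \<mu>" "\<mu> < 1" for \<mu>
  proof -
    have "\<mu> \<notin> \<int>" using that by (auto elim!: Ints_cases)
    then have "(d \<mu> \<longlongrightarrow> Gamma \<mu> - Gamma \<mu>) (at_right 0)"
      unfolding d_def using that
      by (intro tendsto_diff tendsto_gengamma_0 tendsto_bessel_comb_0)
    then show ?thesis by simp
  qed
  have "d \<nu> w = 0"
  proof (rule singular_system_unique[OF \<nu>, where p = "d \<nu>" and q = "d (1 - \<nu>)"])
    show "(d (1 - \<nu>) has_field_derivative - (x powr (- \<nu>) * d \<nu> x)) (at x)" if "x > 0" for x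
      using der[OF that, of "1 - \<nu>"] by simp
  qed (use assms in \<open>auto intro!: der lim\<close>)
  then show ?thesis by (simp add: d_def)
qed

lemma gengamma_eq_bessel_comb_Suc:
  fixes \<nu> w :: real
  assumes \<nu>: "\<nu> > 0" "\<nu> \<notin> \<int>"
    and eq: "\<And>x. x > 0 \<Longrightarrow> gengamma \<nu> x = bessel_comb \<nu> x" and "w > 0"
  shows "gengamma (\<nu> + 1) w = bessel_comb (\<nu> + 1) w"
proof -
  have "\<nu> + 1 \<notin> \<int>" using \<nu> by (metis Ints_1 Ints_diff add_diff_cancel_right')
  define d where "d = (\<lambda>x. gengamma (\<nu> + 1) x - bessel_comb (\<nu> + 1) x)"
  have der: "(d has_field_derivative 0) (at x)" if "x > 0" for x
  proof -
    have "(d has_field_derivative - gengamma (\<nu> + 1 - 1) x - - bessel_comb (\<nu> + 1 - 1) x) (at x)"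
      unfolding d_def by (intro DERIV_diff DERIV_gengamma DERIV_bessel_comb that)
    then show ?thesis using eq[OF that] by simp
  qed
  have lim: "(d \<longlongrightarrow> 0) (at_right 0)"
  proof -
    have "(d \<longlongrightarrow> Gamma (\<nu> + 1) - Gamma (\<nu> + 1)) (at_right 0)"
      unfolding d_def using \<nu> \<open>\<nu> + 1 \<notin> \<int>\<close>
      by (intro tendsto_diff tendsto_gengamma_0 tendsto_bessel_comb_0) auto
    then show ?thesis by simp
  qed
  \<comment> \<open>The derivative of \<open>d\<close> is 0, so the sign lemma applies to both
    \<open>d\<close> and \<open>- d\<close>.\<close>
  have "d w \<le> 0"
    by (rule nonpos_if_DERIV_nonpos_tendsto_0[where f' = "\<lambda>_. 0"]) (use der lim assms in auto)
  moreover have "- d w \<le> 0"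
  proof (rule nonpos_if_DERIV_nonpos_tendsto_0[where f = "\<lambda>x. - d x" and f' = "\<lambda>_. 0"])
    show "((\<lambda>x. - d x) has_field_derivative 0) (at x)" if "x > 0" for x
      using DERIV_minus[OF der[OF that]] by simp
    show "((\<lambda>x. - d x) \<longlongrightarrow> 0) (at_right 0)" using tendsto_minus[OF lim] by simp
  qed (use assms in auto)
  ultimately show ?thesis by (simp add: d_def)
qed

lemma gengamma_eq_bessel_comb:
  fixes \<nu> w :: real
  assumes "\<nu> \<notin> \<int>" "w > 0"
  shows "gengamma \<nu> w = bessel_comb \<nu> w"
proof -
  have pos: "gengamma \<mu> w = bessel_comb \<mu> w" if "\<mu> > 0" "\<mu> \<notin> \<int>" for \<mu>
  proof -
    have frac: "0 < frac \<mu>" "frac \<mu> < 1"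
      using that by (auto simp: frac_gt_0_iff frac_lt_1)
    have "frac \<mu> + real n \<notin> \<int>" for n
      by (metis Ints_diff Ints_of_nat add_diff_cancel_right' frac_in_Ints_iff that(2))
    \<comment> \<open>Induction on the integer part, starting in (0, 1). The claim is kept for all x
      > 0, because the step differentiates in x and lets x -> 0.\<close>
    then have "gengamma (frac \<mu> + real n) x = bessel_comb (frac \<mu> + real n) x"
      if "x > 0" for n x
      using that
    proof (induction n arbitrary: x)
      case 0
      then show ?case using gengamma_eq_bessel_comb_01[OF frac] by simp
    next
      case (Suc n)
      have "gengamma (frac \<mu> + real n + 1) x = bessel_comb (frac \<mu> + real n + 1) x"
        using frac Suc by (intro gengamma_eq_bessel_comb_Suc add_pos_nonneg) auto
      then show ?case by (simp add: add_ac)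
    qed
    from this[OF assms(2), of "nat \<lfloor>\<mu>\<rfloor>"] show ?thesis
      using that by (simp add: frac_def)
  qed
  show ?thesis
  proof (cases "\<nu> > 0")
    case False
    then have "- \<nu> > 0" "- \<nu> \<notin> \<int>" using assms by (auto simp: less_le)
    then show ?thesis
      using pos[of "- \<nu>"] gengamma_minus[OF assms(2), of "- \<nu>"]
        bessel_comb_minus[OF assms(2), of "- \<nu>"] by simp
  qed (use pos assms in auto)
qed

section \<open>Passage to the modified Bessel functions\<close>

lemma bessel_I_eq_bessel_series:
  fixes \<nu> w :: real
  assumes "w > 0"
  shows "bessel_I \<nu> (2 * sqrt w) = w powr (\<nu> / 2) * bessel_series \<nu> w"
proof -
  have "(2 * sqrt w / 2) powr (2 * real k + \<nu>) = w powr (\<nu> / 2) * w ^ k" for k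
  proof -
    have "(2 * sqrt w / 2) powr (2 * real k + \<nu>) = (w powr (1 / 2)) powr (2 * real k + \<nu>)"
      using assms by (simp add: powr_half_sqrt)
    also have "\<dots> = w powr (\<nu> / 2 + real k)"
      by (simp add: powr_powr add_divide_distrib add.commute)
    finally show ?thesis using assms by (simp add: powr_add powr_realpow)
  qed
  then show ?thesis
    unfolding bessel_I_def bessel_series_def
    by (subst suminf_mult[OF summable_bessel_series, symmetric]) (simp add: mult_ac)
qed

lemma bessel_K_eq_gengamma:
  fixes \<nu> w :: real
  assumes "w > 0"
  shows "bessel_K \<nu> (2 * sqrt w) = w powr (- \<nu> / 2) * gengamma \<nu> w / 2"
proof -
  define K where "K = (\<lambda>\<mu>. pi / 2 * (bessel_I (- \<mu>) (2 * sqrt w) - bessel_I \<mu> (2 * sqrt w))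
    / sin (\<mu> * pi))"
  define g where "g = (\<lambda>\<mu>. w powr (- \<mu> / 2) * gengamma \<mu> w / 2)"
  have K: "K \<mu> = g \<mu>" if "\<mu> \<notin> \<int>" for \<mu>
  proof -
    have "w powr (\<mu> / 2) = w powr (- \<mu> / 2) * w powr \<mu>"
      by (simp flip: powr_add)
    then show ?thesis
      unfolding K_def g_def bessel_I_eq_bessel_series[OF assms]
        gengamma_eq_bessel_comb[OF that assms] bessel_comb_def
      by (simp add: algebra_simps diff_divide_distrib)
  qed
  \<comment> \<open>Around an integer the punctured interval of radius 1 contains no integer, so
    there \<open>K\<close> agrees with \<open>g\<close>, which is continuous in the order.\<close>
  have "Lim (at \<nu>) K = g \<nu>" if "\<nu> \<in> \<int>"
  proof (rule tendsto_Lim)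
    have "(g \<longlongrightarrow> g \<nu>) (at \<nu>)"
      unfolding g_def
      using assms by (intro tendsto_intros isContD isCont_gengamma_order) auto
    moreover have "\<forall>\<^sub>F \<mu> in at \<nu>. g \<mu> = K \<mu>"
      unfolding eventually_at
    proof (intro exI[of _ 1] conjI ballI impI)
      fix \<mu> assume \<mu>: "\<mu> \<noteq> \<nu> \<and> dist \<mu> \<nu> < 1"
      have "\<mu> \<notin> \<int>"
      proof
        assume "\<mu> \<in> \<int>"
        then have "\<mu> = \<nu>"
          using \<mu> Ints_eq_abs_less1[of \<mu> \<nu>] that by (simp add: dist_real_def)
        then show False using \<mu> by simp
      qed
      then show "g \<mu> = K \<mu>" by (simp add: K)
    qed simp
    ultimately show "(K \<longlongrightarrow> g \<nu>) (at \<nu>)" by (rule Lim_transform_eventually)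
  qed simp
  moreover have "bessel_K \<nu> (2 * sqrt w) = (if \<nu> \<in> \<int> then Lim (at \<nu>) K else K \<nu>)"
    unfolding bessel_K_def Let_def K_def ..
  ultimately have "bessel_K \<nu> (2 * sqrt w) = g \<nu>"
    using K by simp
  then show ?thesis unfolding g_def .
qed

section \<open>The density of the symmetric K-distribution\<close>

theorem mainTheorem1:
  fixes \<alpha> \<zeta> \<delta> \<gamma> :: real and f :: "real \<Rightarrow> real"
  assumes "\<alpha> > 0" and "\<zeta> > 0" and "\<delta> > 0"
    and "\<And>x. f x =
      (LBINT \<beta>:{0<..}.
         (\<bar>x - \<gamma>\<bar> powr (\<alpha> - 1) / (2 * \<beta> powr \<alpha> * Gamma \<alpha>) * exp (- (\<bar>x - \<gamma>\<bar> / \<beta>))) *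
         (\<delta> powr \<zeta> * \<beta> powr (\<zeta> - 1) / Gamma \<zeta> * exp (- (\<delta> * \<beta>))))"
  shows "\<forall>x. \<bar>x - \<gamma>\<bar> > 0 \<longrightarrow>
    f x = \<delta> powr ((\<alpha> + \<zeta>) / 2) / (Gamma \<alpha> * Gamma \<zeta>)
      * \<bar>x - \<gamma>\<bar> powr ((\<alpha> + \<zeta>) / 2 - 1)
      * bessel_K (\<alpha> - \<zeta>) (2 * sqrt (\<delta> * \<bar>x - \<gamma>\<bar>))"
proof (intro allI impI)
  fix x :: real
  define y where "y = \<bar>x - \<gamma>\<bar>"
  assume "\<bar>x - \<gamma>\<bar> > 0"
  then have y: "y > 0" by (simp add: y_def)
  let ?\<nu> = "\<alpha> - \<zeta>"
  \<comment> \<open>The part of the integrand that depends on the mixing variable, in the form of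
    \<open>gengamma_reflect_scale\<close> with a = \<delta> and c = y; the remaining factors form
    \<open>C\<close>.\<close>
  define h where "h = (\<lambda>t. t powr (- ?\<nu> - 1) * exp (- (\<delta> * t) - y / t))"
  define C where "C = y powr (\<alpha> - 1) * \<delta> powr \<zeta> / (2 * Gamma \<alpha> * Gamma \<zeta>)"
  have "f x = (LBINT t:{0<..}. C * h t)"
    unfolding assms(4) y_def[symmetric]
  proof (rule set_lebesgue_integral_cong)
    show "\<forall>t. t \<in> {0<..} \<longrightarrow>
      y powr (\<alpha> - 1) / (2 * t powr \<alpha> * Gamma \<alpha>) * exp (- (y / t)) *
        (\<delta> powr \<zeta> * t powr (\<zeta> - 1) / Gamma \<zeta> * exp (- (\<delta> * t))) = C * h t"
    proof (intro allI impI)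
      fix t :: real assume "t \<in> {0<..}"
      then have t: "t > 0" by simp
      have h: "h t = t powr (\<zeta> - 1) / t powr \<alpha> * (exp (- (y / t)) * exp (- (\<delta> * t)))"
        using t by (simp add: h_def algebra_simps flip: exp_add powr_diff)
      show "y powr (\<alpha> - 1) / (2 * t powr \<alpha> * Gamma \<alpha>) * exp (- (y / t)) *
          (\<delta> powr \<zeta> * t powr (\<zeta> - 1) / Gamma \<zeta> * exp (- (\<delta> * t))) = C * h t"
        unfolding h C_def by (simp add: mult_ac)
    qed
  qed simp
  also have "\<dots> = C * integral {0<..} h"
  proof -
    have "h absolutely_integrable_on {0<..}"
      unfolding h_def using assms y by (intro gengamma_reflect_scale)
    \<comment> \<open>Absolute integrability refers to the completed Lebesgue measure; since
      \<open>h\<close> is Borel measurable, it carries over to \<open>lborel\<close>, over which the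
      density is integrated.\<close>
    then have "set_integrable lborel {0<..} h"
      unfolding set_integrable_def h_def by (subst (asm) integrable_completion) auto
    then show ?thesis by (simp add: set_borel_integral_eq_integral)
  qed
  also have "integral {0<..} h = y powr (- ?\<nu>) * gengamma ?\<nu> (\<delta> * y)"
    unfolding h_def using assms y by (intro gengamma_reflect_scale)
  also have "gengamma ?\<nu> (\<delta> * y) = 2 * (\<delta> * y) powr (?\<nu> / 2) * bessel_K ?\<nu> (2 * sqrt (\<delta> * y))"
  proof -
    have "(\<delta> * y) powr (?\<nu> / 2) * (\<delta> * y) powr (- ?\<nu> / 2) = 1"
      unfolding powr_add[symmetric] using assms(3) y by (simp flip: add_divide_distrib)
    moreover have "\<delta> * y > 0" using assms(3) y by simp
    ultimately show ?thesis by (simp only: bessel_K_eq_gengamma) simp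
  qed
  also have "C * (y powr (- ?\<nu>) * (2 * (\<delta> * y) powr (?\<nu> / 2) * bessel_K ?\<nu> (2 * sqrt (\<delta> * y))))
      = (\<delta> powr \<zeta> * \<delta> powr (?\<nu> / 2)) / (Gamma \<alpha> * Gamma \<zeta>)
        * (y powr (\<alpha> - 1) * y powr (- ?\<nu>) * y powr (?\<nu> / 2))
        * bessel_K ?\<nu> (2 * sqrt (\<delta> * y))"
    using assms y by (simp add: C_def powr_mult)
  also have "\<delta> powr \<zeta> * \<delta> powr (?\<nu> / 2) = \<delta> powr ((\<alpha> + \<zeta>) / 2)"
    by (simp add: field_simps flip: powr_add)
  also have "y powr (\<alpha> - 1) * y powr (- ?\<nu>) * y powr (?\<nu> / 2) = y powr ((\<alpha> + \<zeta>) / 2 - 1)"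
    by (simp add: field_simps flip: powr_add)
  finally show "f x = \<delta> powr ((\<alpha> + \<zeta>) / 2) / (Gamma \<alpha> * Gamma \<zeta>)
      * \<bar>x - \<gamma>\<bar> powr ((\<alpha> + \<zeta>) / 2 - 1)
      * bessel_K (\<alpha> - \<zeta>) (2 * sqrt (\<delta> * \<bar>x - \<gamma>\<bar>))"
    unfolding y_def .
qed

end
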